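(* Let $\alpha$ be a square-free positive rational number, let $\mathcal T$ be a primitive factorization tree for $\alpha$, and let $\mathcal G=(G,\mu)$ be a measure class graph for $\mathcal T$. Then the digraph $G$ is a binary tree, i.e., a rooted tree (with edges directed from each vertex to its children) in which every vertex has at most two children.
   Context: Write $\alpha=a/b$ with $a,b$ coprime positive integers; $\alpha$ is square-free if $a$ and $b$ are both square-free. Let $p_1\ge\cdots\ge p_N$ be the primes dividing $ab$, listed with multiplicity. Put $\gamma(i)=1$ if $p_i\mid a$, $\gamma(i)=-1$ if $p_i\mid b$, and $\alpha_n=\prod_{i=1}^n p_i^{\gamma(i)}$ for $0\le n\le N$. A factorization of a positive rational $\beta$ is a sequence $(a_1/b_1,a_2/b_2,\dots)$ with $a_i,b_i$ positive integers, $a_i=b_i=1$ for all but finitely many $i$, $\prod_i a_i/b_i=\beta$, $\max\{a_i,b_i\}\ge\max\{a_{i+1},b_{i+1}\}$ for all $i$, and $\gcd(a_i,b_j)=1$ for all $i,j$; it is primitive if each $\max\{a_i,b_i\}$ is prime or $1$. Let $\mathfrak F_\alpha$ ($\mathfrak P_\alpha$) be the set of all (primitive) factorizations of $\alpha_n$, $0\le n\le N$. For $0\le n<N$, a factorization $(a_i/b_i)$ of $\alpha_n$ is a direct subfactorization of a factorization $(c_i/d_i)$ of $\alpha_{n+1}$ if either $p_{n+1}\mid a$ and for some $k$: $d_i=b_i$ for all $i$, $c_i=a_i$ for $i\ne k$, $c_k=a_kp_{n+1}$; or $p_{n+1}\mid b$ and for some $k$: $c_i=a_i$ for all $i$, $d_i=b_i$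 for $i\ne k$, $d_k=b_kp_{n+1}$. A factorization tree for $\alpha$ is a pair $(T,\nu)$ with $T$ a rooted tree (digraph with edges from each vertex to its children) and $\nu:V(T)\to\mathfrak F_\alpha$, with parenting map $\phi$, such that: (1) root $r_0$ has $\nu(r_0)=(1,1,\dots)$; (2) if $n<N$ and $\nu(r)$ is a factorization of $\alpha_n$ then $r$ has a child; (3) $\nu(r)=\nu(s)$ and $\phi(r)=\phi(s)$ imply $r=s$; (4) for non-root $r$, $\nu(\phi(r))$ is a direct subfactorization of $\nu(r)$. It is primitive if $\nu(V(T))\subseteq\mathfrak P_\alpha$. For $\mathbf A=(a_1/b_1,a_2/b_2,\dots)$ let $m(\mathbf A)=(\log\max\{a_1,b_1\},\log\max\{a_2,b_2\},\dots)$. Elements $\mathbf A,\mathbf B\in\mathfrak F_\alpha$ are measure equivalent, $\mathbf A\sim\mathbf B$, if they are factorizations of the same rational number and $m(\mathbf A)=m(\mathbf B)$; $\overline{\mathfrak F}_\alpha$ is the set of classes $[\mathbf A]$ and $f(\mathbf A)=[\mathbf A]$. A measure class graph for a factorization tree $\mathcal T=(T,\nu)$ is a pair $(G,\mu)$ with $G$ a digraph and $\mu:V(G)\to\overline{\mathfrak F}_\alpha$ injective, such that there exists a surjective map $\pi:V(T)\to V(G)$ with: $(\pi(r),\pi(s))\in E(G)$ whenever $(r,s)\in E(T)$; $\mu(\pi(r))=f(\nu(r))$ for all $r$; and for all $g,h\in\pi(V(T))$ with $(g,h)\in E(G)$ there is $(r,s)\in E(T)$ with $(\pi(r),\pi(s))=(g,h)$.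 *)

theory Defs
  imports
    Complex_Main
    "HOL-Library.Multiset"
    "HOL-Computational_Algebra.Primes"
    "HOL-Computational_Algebra.Squarefree"
    "Graph_Theory.Pair_Digraph"
begin

section \<open>Rooted trees\<close>

text \<open>
  A digraph is a \<^typ>\<open>'v pair_pre_digraph\<close>, so that its edges are ordered pairs of vertices.
  In a rooted tree the edges point away from the root; this is expressed by requiring a unique
  directed walk from the root to each vertex. In particular no edge enters the root, every other
  vertex has exactly one parent, and there are no cycles. Finiteness is not required.
\<close>

definition rooted_tree :: "'v pair_pre_digraph \<Rightarrow> 'v \<Rightarrow> bool" where
  "rooted_tree T r \<longleftrightarrow>
     pair_wf_digraph T \<and> r \<in> pverts T \<and>
     (\<forall>v\<in>pverts T. \<exists>!p. pre_digraph.awalk (with_proj T) r p v)"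

definition children :: "'v pair_pre_digraph \<Rightarrow> 'v \<Rightarrow> 'v set" where
  "children T v = {w. (v, w) \<in> parcs T}"

definition binary_tree :: "'v pair_pre_digraph \<Rightarrow> bool" where
  "binary_tree T \<longleftrightarrow>
     (\<exists>r. rooted_tree T r) \<and> (\<forall>v\<in>pverts T. finite (children T v) \<and> card (children T v) \<le> 2)"


section \<open>Positive rationals\<close>

text \<open>For \<open>\<alpha> > 0\<close> these are the coprime positive integers \<open>a\<close>, \<open>b\<close> with \<open>\<alpha> = a / b\<close>.\<close>

definition rnum :: "rat \<Rightarrow> nat" where
  "rnum \<alpha> = nat (fst (quotient_of \<alpha>))"

definition rden :: "rat \<Rightarrow> nat" where
  "rden \<alpha> = nat (snd (quotient_of \<alpha>))"

definition squarefree_rat :: "rat \<Rightarrow> bool" where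
  "squarefree_rat \<alpha> \<longleftrightarrow> squarefree (rnum \<alpha>) \<and> squarefree (rden \<alpha>)"

text \<open>The primes dividing \<open>a b\<close> with multiplicity, in decreasing order. Sequences are indexed
  from \<open>0\<close> throughout, so \<open>p\<^sub>i\<^sub>+\<^sub>1\<close> is the list entry with index \<open>i\<close>.\<close>

definition prime_seq :: "rat \<Rightarrow> nat list" where
  "prime_seq \<alpha> = rev (sorted_list_of_multiset (prime_factorization (rnum \<alpha> * rden \<alpha>)))"

definition num_primes :: "rat \<Rightarrow> nat" where
  "num_primes \<alpha> = length (prime_seq \<alpha>)"

definition gam :: "rat \<Rightarrow> nat \<Rightarrow> int" where
  "gam \<alpha> i = (if prime_seq \<alpha> ! i dvd rnum \<alpha> then 1 else - 1)"

definition truncation :: "rat \<Rightarrow> nat \<Rightarrow> rat" where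
  "truncation \<alpha> n = (\<Prod>i<n. of_nat (prime_seq \<alpha> ! i) powi gam \<alpha> i)"


section \<open>Factorizations\<close>

text \<open>The entry \<open>a\<^sub>i / b\<^sub>i\<close> is the pair \<open>(a\<^sub>i, b\<^sub>i)\<close>. As \<open>a\<^sub>i\<close> and \<open>b\<^sub>i\<close> are required to be
  coprime, the pair and the rational number determine each other.\<close>

type_synonym fraction_seq = "nat \<Rightarrow> nat \<times> nat"

definition height :: "fraction_seq \<Rightarrow> nat \<Rightarrow> nat" where
  "height A i = max (fst (A i)) (snd (A i))"

definition factorization :: "rat \<Rightarrow> fraction_seq \<Rightarrow> bool" where
  "factorization \<beta> A \<longleftrightarrow>
     (\<forall>i. fst (A i) > 0 \<and> snd (A i) > 0) \<and>
     finite {i. A i \<noteq> (1, 1)} \<and>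
     (\<Prod>i | A i \<noteq> (1, 1). of_nat (fst (A i)) / of_nat (snd (A i))) = \<beta> \<and>
     (\<forall>i. height A i \<ge> height A (Suc i)) \<and>
     (\<forall>i j. gcd (fst (A i)) (snd (A j)) = 1)"

definition primitive :: "fraction_seq \<Rightarrow> bool" where
  "primitive A \<longleftrightarrow> (\<forall>i. prime (height A i) \<or> height A i = 1)"

definition factorizations :: "rat \<Rightarrow> fraction_seq set" where
  "factorizations \<alpha> = {A. \<exists>n\<le>num_primes \<alpha>. factorization (truncation \<alpha> n) A}"

definition primitive_factorizations :: "rat \<Rightarrow> fraction_seq set" where
  "primitive_factorizations \<alpha> = {A \<in> factorizations \<alpha>. primitive A}"

definition direct_subfactorization :: "rat \<Rightarrow> fraction_seq \<Rightarrow> fraction_seq \<Rightarrow> bool" where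
  "direct_subfactorization \<alpha> A C \<longleftrightarrow>
     (\<exists>n<num_primes \<alpha>. let p = prime_seq \<alpha> ! n in
        factorization (truncation \<alpha> n) A \<and>
        factorization (truncation \<alpha> (Suc n)) C \<and>
        (p dvd rnum \<alpha> \<and>
           (\<exists>k. (\<forall>i. snd (C i) = snd (A i)) \<and>
                (\<forall>i. i \<noteq> k \<longrightarrow> fst (C i) = fst (A i)) \<and>
                fst (C k) = fst (A k) * p)
         \<or>
         p dvd rden \<alpha> \<and>
           (\<exists>k. (\<forall>i. fst (C i) = fst (A i)) \<and>
                (\<forall>i. i \<noteq> k \<longrightarrow> snd (C i) = snd (A i)) \<and>
                snd (C k) = snd (A k) * p)))"


section \<open>Factorization trees\<close>

text \<open>\<open>(u, v) \<in> parcs T\<close> says that \<open>u\<close> is the parent of \<open>v\<close>; the root has no parent.\<close>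

definition factorization_tree :: "rat \<Rightarrow> 'v pair_pre_digraph \<Rightarrow> ('v \<Rightarrow> fraction_seq) \<Rightarrow> bool" where
  "factorization_tree \<alpha> T \<nu> \<longleftrightarrow>
     \<nu> ` pverts T \<subseteq> factorizations \<alpha> \<and>
     (\<exists>r\<^sub>0. rooted_tree T r\<^sub>0 \<and> \<nu> r\<^sub>0 = (\<lambda>_. (1, 1))) \<and>
     (\<forall>r\<in>pverts T. \<forall>n<num_primes \<alpha>.
        factorization (truncation \<alpha> n) (\<nu> r) \<longrightarrow> children T r \<noteq> {}) \<and>
     (\<forall>u r s. (u, r) \<in> parcs T \<and> (u, s) \<in> parcs T \<and> \<nu> r = \<nu> s \<longrightarrow> r = s) \<and>
     (\<forall>u r. (u, r) \<in> parcs T \<longrightarrow> direct_subfactorization \<alpha> (\<nu> u) (\<nu> r))"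

definition primitive_factorization_tree ::
  "rat \<Rightarrow> 'v pair_pre_digraph \<Rightarrow> ('v \<Rightarrow> fraction_seq) \<Rightarrow> bool" where
  "primitive_factorization_tree \<alpha> T \<nu> \<longleftrightarrow>
     factorization_tree \<alpha> T \<nu> \<and> \<nu> ` pverts T \<subseteq> primitive_factorizations \<alpha>"


section \<open>Measure class graphs\<close>

definition log_heights :: "fraction_seq \<Rightarrow> nat \<Rightarrow> real" where
  "log_heights A i = ln (real (height A i))"

definition measure_equiv :: "rat \<Rightarrow> (fraction_seq \<times> fraction_seq) set" where
  "measure_equiv \<alpha> =
     {(A, B). A \<in> factorizations \<alpha> \<and> B \<in> factorizations \<alpha> \<and>
        (\<exists>\<beta>. factorization \<beta> A \<and> factorization \<beta> B) \<and> log_heights A = log_heights B}"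

definition measure_classes :: "rat \<Rightarrow> fraction_seq set set" where
  "measure_classes \<alpha> = factorizations \<alpha> // measure_equiv \<alpha>"

definition measure_class :: "rat \<Rightarrow> fraction_seq \<Rightarrow> fraction_seq set" where
  "measure_class \<alpha> A = measure_equiv \<alpha> `` {A}"

definition measure_class_graph ::
  "rat \<Rightarrow> 'v pair_pre_digraph \<Rightarrow> ('v \<Rightarrow> fraction_seq) \<Rightarrow>
   'g pair_pre_digraph \<Rightarrow> ('g \<Rightarrow> fraction_seq set) \<Rightarrow> bool" where
  "measure_class_graph \<alpha> T \<nu> G \<mu> \<longleftrightarrow>
     pair_wf_digraph G \<and>
     \<mu> ` pverts G \<subseteq> measure_classes \<alpha> \<and>
     inj_on \<mu> (pverts G) \<and>
     (\<exists>\<pi>. \<pi> ` pverts T = pverts G \<and>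
        (\<forall>r s. (r, s) \<in> parcs T \<longrightarrow> (\<pi> r, \<pi> s) \<in> parcs G) \<and>
        (\<forall>r\<in>pverts T. \<mu> (\<pi> r) = measure_class \<alpha> (\<nu> r)) \<and>
        (\<forall>g\<in>\<pi> ` pverts T. \<forall>h\<in>\<pi> ` pverts T. (g, h) \<in> parcs G \<longrightarrow>
           (\<exists>r s. (r, s) \<in> parcs T \<and> (\<pi> r, \<pi> s) = (g, h))))"

end

theory Submission
  imports Defs
begin

text \<open>
  The primes \<open>p\<^sub>1 > p\<^sub>2 > \<dots>\<close> are distinct, so when \<open>p = p\<^sub>n\<^sub>+\<^sub>1\<close> is attached to a primitive
  factorization of \<open>\<alpha>\<^sub>n\<close> it is smaller than every prime already present. Primitivity of the result
  then leaves two possibilities for the sequence of heights: it is unchanged, or its first entry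
  equal to \<open>1\<close> becomes \<open>p\<close>. Hence a measure class has at most two children. Conversely \<open>p\<close> does not
  occur among the heights of the parent, which are therefore recovered by replacing \<open>p\<close> with \<open>1\<close>;
  so the class of the parent is determined by the class of the child.
\<close>

section \<open>Directed walks and rooted trees\<close>

text \<open>Walks are compared from their last edge backwards: a unique parent fixes that edge, and
  a walk ending at the root must be empty because nothing enters the root.\<close>

lemma rooted_tree_if_unique_parent:
  assumes wf: "pair_wf_digraph G" and r: "r \<in> pverts G"
    and reach: "\<And>v. v \<in> pverts G \<Longrightarrow> \<exists>p. pre_digraph.awalk (with_proj G) r p v"
    and root: "\<And>u. (u, r) \<notin> parcs G"
    and parent: "\<And>u u' v. (u, v) \<in> parcs G \<Longrightarrow> (u', v) \<in> parcs G \<Longrightarrow> u = u'"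
  shows "rooted_tree G r"
proof -
  interpret pair_wf_digraph G by (rule wf)
  have last: "(awlast r p, v) = e \<and> e \<in> parcs G \<and> awalk r p (awlast r p)"
    if "awalk r (p @ [e]) v" for p e v
    using that by (cases e) (auto simp: awalk_simps)
  have no_snoc: False if "awalk r (p @ [e]) r" for p e
    using last[OF that] root by auto
  have unique: "p = q" if "awalk r p v" "awalk r q v" for p q v
    using that
  proof (induction p arbitrary: q v rule: rev_induct)
    case Nil
    then have "v = r" by (auto simp: awalk_simps)
    then show ?case using Nil(2) no_snoc by (cases q rule: rev_cases) auto
  next
    case (snoc e p)
    show ?case
    proof (cases q rule: rev_cases)
      case Nil
      then have "v = r" using snoc.prems(2) by (auto simp: awalk_simps)
      then show ?thesis using snoc.prems(1) no_snoc by blast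
    next
      case q: (snoc q' f)
      have e: "(awlast r p, v) = e" "e \<in> parcs G" "awalk r p (awlast r p)"
        using last[OF snoc.prems(1)] by auto
      have "awalk r (q' @ [f]) v" using snoc.prems(2) q by simp
      from last[OF this]
      have f: "(awlast r q', v) = f" "f \<in> parcs G" "awalk r q' (awlast r q')" by auto
      have same: "awlast r p = awlast r q'"
        by (rule parent[of _ v]) (use e(1,2) f(1,2) in \<open>simp_all only:\<close>)
      then have "p = q'" using snoc.IH[OF e(3)] f(3) by (simp only:)
      moreover have "e = f" using same e(1) f(1) by (simp only:)
      ultimately show ?thesis using q by (simp only:)
    qed
  qed
  show ?thesis
    unfolding rooted_tree_def using wf r reach unique by blast
qed

text \<open>Carries reachability from the root of the factorization tree over to the measure class
  graph. Some walk suffices, since uniqueness there comes from unique parents.\<close>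

lemma awalk_image:
  assumes "pair_wf_digraph T" "pair_wf_digraph G"
    and "\<pi> ` pverts T \<subseteq> pverts G"
    and "\<And>r s. (r, s) \<in> parcs T \<Longrightarrow> (\<pi> r, \<pi> s) \<in> parcs G"
    and "pre_digraph.awalk (with_proj T) u p v"
  shows "\<exists>q. pre_digraph.awalk (with_proj G) (\<pi> u) q (\<pi> v)"
proof -
  interpret T: pair_wf_digraph T by (rule assms(1))
  interpret G: pair_wf_digraph G by (rule assms(2))
  show ?thesis
    using assms(5)
  proof (induction p arbitrary: u)
    case Nil
    then have "G.awalk (\<pi> u) [] (\<pi> v)"
      using assms(3) by (auto simp: T.awalk_simps G.awalk_simps)
    then show ?case by blast
  next
    case (Cons e p)
    then have e: "e \<in> parcs T" "u = fst e" "T.awalk (snd e) p v"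
      by (auto simp: T.awalk_simps)
    obtain q where "G.awalk (\<pi> (snd e)) q (\<pi> v)" using Cons.IH e by blast
    moreover have "(\<pi> (fst e), \<pi> (snd e)) \<in> parcs G" using assms(4) e by simp
    ultimately have "G.awalk (\<pi> u) ((\<pi> (fst e), \<pi> (snd e)) # q) (\<pi> v)"
      using e by (auto simp: G.awalk_simps)
    then show ?case by blast
  qed
qed

section \<open>Primes occurring in a factorization\<close>

lemma factorization_unique:
  "factorization \<beta> A \<Longrightarrow> factorization \<gamma> A \<Longrightarrow> \<beta> = \<gamma>"
  unfolding factorization_def by blast

lemma squarefree_rat_mult:
  assumes "squarefree_rat \<alpha>"
  shows "squarefree (rnum \<alpha> * rden \<alpha>)"
proof -
  have "squarefree (rnum \<alpha>)" "squarefree (rden \<alpha>)"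
    using assms by (auto simp: squarefree_rat_def)
  moreover obtain a b where ab: "quotient_of \<alpha> = (a, b)" by fastforce
  \<comment> \<open>\<open>nat\<close> sends nonpositive integers to 0, so this makes the numerator
    positive and \<open>int (rnum \<alpha>)\<close> equal to it.\<close>
  moreover have "rnum \<alpha> \<noteq> 0" using calculation(1) by (metis not_squarefree_0)
  moreover have "coprime a b" "b > 0"
    using ab quotient_of_coprime quotient_of_denom_pos by auto
  ultimately have "coprime (int (rnum \<alpha>)) (int (rden \<alpha>))"
    by (auto simp: rnum_def rden_def)
  then show ?thesis
    using \<open>squarefree (rnum \<alpha>)\<close> \<open>squarefree (rden \<alpha>)\<close>
    by (auto intro: squarefree_mult_coprime)
qed

lemma distinct_prime_seq:
  assumes "squarefree_rat \<alpha>"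
  shows "distinct (prime_seq \<alpha>)"
proof -
  let ?m = "rnum \<alpha> * rden \<alpha>"
  have sf: "squarefree ?m" by (rule squarefree_rat_mult[OF assms])
  then have "?m \<noteq> 0" by (metis not_squarefree_0)
  have "count (prime_factorization ?m) q \<le> 1" for q
    using sf \<open>?m \<noteq> 0\<close>
    by (cases "q \<in> prime_factors ?m")
      (auto simp: squarefree_factorial_semiring' in_prime_factors_imp_prime
        count_prime_factorization_prime not_in_iff simp flip: One_nat_def)
  then show ?thesis
    unfolding distinct_count_atmost_1 prime_seq_def
    by (auto simp: Suc_le_eq le_antisym not_in_iff simp flip: count_greater_zero_iff)
qed

lemma prime_prime_seq: "i < num_primes \<alpha> \<Longrightarrow> prime (prime_seq \<alpha> ! i)"
  using nth_mem[of i "prime_seq \<alpha>"]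
  by (auto simp: num_primes_def prime_seq_def simp del: nth_mem)

text \<open>Sorting gives the weak inequality and distinctness makes it strict; this is the form in
  which square-freeness is used later.\<close>

lemma prime_seq_less:
  assumes "squarefree_rat \<alpha>" "i < j" "j < num_primes \<alpha>"
  shows "prime_seq \<alpha> ! j < prime_seq \<alpha> ! i"
proof -
  have "sorted (rev (prime_seq \<alpha>))" by (simp add: prime_seq_def)
  then have "prime_seq \<alpha> ! j \<le> prime_seq \<alpha> ! i"
    using assms by (simp add: sorted_rev_nth_mono num_primes_def)
  moreover have "prime_seq \<alpha> ! j \<noteq> prime_seq \<alpha> ! i"
    using distinct_prime_seq[OF assms(1)] assms by (simp add: nth_eq_iff_index_eq num_primes_def)
  ultimately show ?thesis by simp
qed

text \<open>The gcd condition over all pairs of indices makes the product of the numerators coprime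
  to that of the denominators. Fractions in lowest terms are unique, so these two products match the
  numerator and denominator of the truncation.\<close>

lemma factorization_prod:
  assumes sf: "squarefree_rat \<alpha>" and n: "n \<le> num_primes \<alpha>"
    and A: "factorization (truncation \<alpha> n) A"
  shows "(\<Prod>i | A i \<noteq> (1, 1). fst (A i) * snd (A i)) = (\<Prod>i<n. prime_seq \<alpha> ! i)"
proof -
  let ?S = "{i. A i \<noteq> (1, 1)}"
  let ?p = "\<lambda>i. prime_seq \<alpha> ! i"
  \<comment> \<open>The primes are split by the sign of \<open>gam\<close>, so that the truncation
    becomes a quotient of two natural numbers.\<close>
  let ?x = "\<lambda>i. if ?p i dvd rnum \<alpha> then ?p i else 1"
  let ?y = "\<lambda>i. if ?p i dvd rnum \<alpha> then 1 else ?p i"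
  define P where "P = (\<Prod>i\<in>?S. fst (A i))"
  define Q where "Q = (\<Prod>i\<in>?S. snd (A i))"
  define X where "X = prod ?x {..<n}"
  define Y where "Y = prod ?y {..<n}"
  have "truncation \<alpha> n = (\<Prod>i<n. of_nat (?x i) / of_nat (?y i))"
    unfolding truncation_def by (rule prod.cong) (auto simp: gam_def power_int_minus field_simps)
  then have trunc: "truncation \<alpha> n = of_nat X / of_nat Y"
    by (simp only: prod_dividef X_def Y_def of_nat_prod)
  have "truncation \<alpha> n = (\<Prod>i\<in>?S. of_nat (fst (A i)) / of_nat (snd (A i)))"
    using A by (simp add: factorization_def)
  then have "truncation \<alpha> n = of_nat P / of_nat Q"
    by (simp only: prod_dividef P_def Q_def of_nat_prod)
  with trunc have "of_nat X / of_nat Y = (of_nat P / of_nat Q :: rat)" by simp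
  moreover have "Q > 0" using A by (auto simp: Q_def factorization_def intro: prod_pos)
  moreover have "Y > 0" unfolding Y_def
    using prime_prime_seq n by (intro prod_pos) (auto simp: prime_gt_0_nat)
  ultimately have "of_nat (P * Y) = (of_nat (X * Q) :: rat)" by (simp add: field_simps)
  then have eq: "P * Y = X * Q" by (simp only: of_nat_eq_iff)
  have "coprime P Q" unfolding P_def Q_def
    using A by (intro prod_coprime_left prod_coprime_right) (auto simp: factorization_def coprime_iff_gcd_eq_1)
  moreover have "coprime X Y" unfolding X_def Y_def
  proof (intro prod_coprime_left prod_coprime_right)
    fix i j assume "i \<in> {..<n}" "j \<in> {..<n}"
    \<comment> \<open>If neither side is 1, one prime divides \<open>rnum \<alpha>\<close> and the
      other does not, so they are distinct.\<close>
    then show "coprime (?x i) (?y j)"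
      using prime_prime_seq[of i \<alpha>] prime_prime_seq[of j \<alpha>] n
      by (auto intro!: primes_coprime)
  qed
  ultimately have "P = X \<and> Q = Y"
    using eq coprime_crossproduct_nat[of P Q X Y] by (simp add: coprime_commute ac_simps)
  then have "P * Q = prod (\<lambda>i. ?x i * ?y i) {..<n}"
    by (simp only: X_def Y_def prod.distrib)
  also have "\<dots> = (\<Prod>i<n. ?p i)" by (rule prod.cong) auto
  finally show ?thesis by (simp add: P_def Q_def prod.distrib)
qed

text \<open>Euclid's lemma applied to both products in \<open>factorization_prod\<close>; entries
  outside the support contribute no prime.\<close>

lemma prime_dvd_factorization_iff:
  assumes "squarefree_rat \<alpha>" and n: "n \<le> num_primes \<alpha>"
    and A: "factorization (truncation \<alpha> n) A" and q: "prime q"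
  shows "(\<exists>i. q dvd fst (A i) * snd (A i)) \<longleftrightarrow> (\<exists>j<n. q = prime_seq \<alpha> ! j)"
proof -
  have "finite {i. A i \<noteq> (1, 1)}" using A by (simp add: factorization_def)
  have nontrivial: "A i \<noteq> (1, 1)" if "q dvd fst (A i) * snd (A i)" for i
    using that prime_gt_1_nat[OF q] by auto
  have "q dvd (\<Prod>i | A i \<noteq> (1, 1). fst (A i) * snd (A i)) \<longleftrightarrow>
      (\<exists>i\<in>{i. A i \<noteq> (1, 1)}. q dvd fst (A i) * snd (A i))"
    using \<open>finite _\<close> q by (rule prime_dvd_prod_iff)
  also have "\<dots> \<longleftrightarrow> (\<exists>i. q dvd fst (A i) * snd (A i))"
    using nontrivial by blast
  finally have "(\<exists>i. q dvd fst (A i) * snd (A i)) \<longleftrightarrow> q dvd (\<Prod>i<n. prime_seq \<alpha> ! i)"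
    using factorization_prod[OF assms(1-3)] by simp
  also have "\<dots> \<longleftrightarrow> (\<exists>j<n. q dvd prime_seq \<alpha> ! j)"
    using prime_dvd_prod_iff[OF _ q, of "{..<n}"] by auto
  also have "\<dots> \<longleftrightarrow> (\<exists>j<n. q = prime_seq \<alpha> ! j)"
    using prime_prime_seq n q by (metis dvd_refl order_less_le_trans primes_dvd_imp_eq)
  finally show ?thesis .
qed

text \<open>For \<open>n < m\<close> the prime with index \<open>n\<close> occurs in every
  factorization at level \<open>m\<close> and, by strict decrease, in none at level
  \<open>n\<close>.\<close>

lemma factorization_level_unique:
  assumes "squarefree_rat \<alpha>" "n \<le> num_primes \<alpha>" "m \<le> num_primes \<alpha>"
    and "factorization (truncation \<alpha> n) A" "factorization (truncation \<alpha> m) A"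
  shows "n = m"
proof (rule ccontr)
  have *: False if "n < m" "m \<le> num_primes \<alpha>"
    "factorization (truncation \<alpha> n) A" "factorization (truncation \<alpha> m) A" for n m
  proof -
    note h = that
    have p: "prime (prime_seq \<alpha> ! n)" using prime_prime_seq that by simp
    have "\<exists>i. prime_seq \<alpha> ! n dvd fst (A i) * snd (A i)"
      using prime_dvd_factorization_iff[OF assms(1) that(2,4) p] that(1) by blast
    then obtain j where "j < n" "prime_seq \<alpha> ! n = prime_seq \<alpha> ! j"
      using prime_dvd_factorization_iff[OF assms(1) _ h(3) p] h(1,2) by auto
    then show False using prime_seq_less[OF assms(1), of j n] that by simp
  qed
  assume "n \<noteq> m"
  then show False using * assms(2-5) by (meson linorder_neqE_nat)
qed

section \<open>Heights along a direct subfactorization\<close>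

text \<open>Here \<open>x\<close> is the component that receives \<open>p\<close>. If
  \<open>x * p\<close> is the maximum, it must be prime, so \<open>x = 1\<close>; then
  \<open>y \<le> p\<close>, while every prime factor of \<open>y\<close> exceeds \<open>p\<close>,
  hence \<open>y = 1\<close>. Otherwise \<open>y\<close> is the maximum both before and
  after.\<close>

lemma max_mult_prime_cases:
  fixes x y p :: nat
  assumes "x > 0" "y > 0" "prime p"
    and large: "\<And>q. prime q \<Longrightarrow> q dvd x * y \<Longrightarrow> p < q"
    and "prime (max (x * p) y) \<or> max (x * p) y = 1"
  shows "x = 1 \<and> y = 1 \<or> max (x * p) y = max x y"
proof (cases "y \<le> x * p")
  case True
  have "p > 1" using \<open>prime p\<close> by (rule prime_gt_1_nat)
  then have "x * p \<noteq> 1" by simp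
  then have "prime (x * p)" using assms(5) True by (auto simp: max_def split: if_splits)
  then have "x = 1" using prime_product[of x p] \<open>p > 1\<close> by auto
  moreover have "y = 1"
  proof (rule ccontr)
    assume "y \<noteq> 1"
    then obtain q where q: "prime q" "q dvd y" using prime_factor_nat by blast
    then have "p < q" using large by simp
    moreover have "q \<le> y" using q \<open>y > 0\<close> by (simp add: dvd_imp_le)
    ultimately show False using True \<open>x = 1\<close> by simp
  qed
  ultimately show ?thesis by simp
next
  case False
  moreover have "x \<le> x * p" using prime_gt_0_nat[OF \<open>prime p\<close>] by simp
  ultimately have "x \<le> y" by linarith
  then show ?thesis using False by simp
qed

text \<open>The equivalence makes \<open>k\<close> the first index of height 1 and at the same time
  says that all later heights are 1.\<close>

definition height_step :: "nat \<Rightarrow> fraction_seq \<Rightarrow> fraction_seq \<Rightarrow> bool" where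
  "height_step p A C \<longleftrightarrow> height C = height A \<or>
     (\<exists>k. (\<forall>i. i < k \<longleftrightarrow> height A i \<noteq> 1) \<and> height C = (height A)(k := p))"

text \<open>By \<open>max_mult_prime_cases\<close> a height can change only from 1 to the new prime,
  and only at one entry; monotonicity of both height sequences forces that entry to be the first of
  height 1. The last conclusion is what makes the step reversible.\<close>

lemma direct_subfactorization_height_step:
  assumes sf: "squarefree_rat \<alpha>" and "primitive A" "primitive C"
    and "direct_subfactorization \<alpha> A C"
  obtains n where "n < num_primes \<alpha>" "factorization (truncation \<alpha> n) A"
    "factorization (truncation \<alpha> (Suc n)) C" "height_step (prime_seq \<alpha> ! n) A C"
    "\<And>i. height A i \<noteq> prime_seq \<alpha> ! n"
proof -
  obtain n where n: "n < num_primes \<alpha>" and A: "factorization (truncation \<alpha> n) A"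
    and C: "factorization (truncation \<alpha> (Suc n)) C"
    and step: "(\<exists>k. (\<forall>i. snd (C i) = snd (A i)) \<and> (\<forall>i. i \<noteq> k \<longrightarrow> fst (C i) = fst (A i)) \<and>
                fst (C k) = fst (A k) * prime_seq \<alpha> ! n) \<or>
           (\<exists>k. (\<forall>i. fst (C i) = fst (A i)) \<and> (\<forall>i. i \<noteq> k \<longrightarrow> snd (C i) = snd (A i)) \<and>
                snd (C k) = snd (A k) * prime_seq \<alpha> ! n)"
    using assms(4) unfolding direct_subfactorization_def Let_def by blast
  define p where "p = prime_seq \<alpha> ! n"
  have p: "prime p" unfolding p_def by (rule prime_prime_seq[OF n])
  have large: "p < q" if "prime q" "q dvd fst (A i) * snd (A i)" for q i
    using prime_dvd_factorization_iff[OF sf _ A that(1)] that(2) n prime_seq_less[OF sf]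
    by (auto simp: p_def)
  have pos: "fst (A i) > 0" "snd (A i) > 0" for i
    using A by (auto simp: factorization_def)
  \<comment> \<open>A height other than 1 is a prime and a component of its entry, so it is one of
    the earlier, larger primes.\<close>
  have height_large: "height A i \<noteq> 1 \<Longrightarrow> p < height A i" for i
  proof -
    assume "height A i \<noteq> 1"
    then have "prime (height A i)" using \<open>primitive A\<close> by (auto simp: primitive_def)
    moreover have "height A i dvd fst (A i) * snd (A i)" by (simp add: height_def max_def)
    ultimately show ?thesis by (rule large)
  qed
  have "decseq (height A)" "decseq (height C)"
    using A C by (auto simp: factorization_def decseq_Suc_iff)
  \<comment> \<open>The numerator and denominator cases merge here: \<open>max\<close> is symmetric,
    so the same lemma applies with the components swapped.\<close>
  obtain k where other: "\<And>i. i \<noteq> k \<Longrightarrow> height C i = height A i"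
    and at: "height A k = 1 \<and> height C k = p \<or> height C k = height A k"
  proof -
    have Cp: "prime (height C k) \<or> height C k = 1" for k
      using \<open>primitive C\<close> by (simp add: primitive_def)
    from step consider
      k where "\<forall>i. snd (C i) = snd (A i)" "\<forall>i. i \<noteq> k \<longrightarrow> fst (C i) = fst (A i)"
        "fst (C k) = fst (A k) * p"
      | k where "\<forall>i. fst (C i) = fst (A i)" "\<forall>i. i \<noteq> k \<longrightarrow> snd (C i) = snd (A i)"
        "snd (C k) = snd (A k) * p"
      unfolding p_def by blast
    then show ?thesis
    proof cases
      case 1
      with max_mult_prime_cases[OF pos[of k] p large[of _ k]] Cp[of k] p
      show ?thesis by (intro that[of k]) (auto simp: height_def prime_gt_0_nat max_def Suc_leI)
    next
      case 2
      with max_mult_prime_cases[OF pos(2)[of k] pos(1)[of k] p large[of _ k]] Cp[of k] p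
      show ?thesis
        by (intro that[of k]) (auto simp: height_def ac_simps prime_gt_0_nat max_def Suc_leI)
    qed
  qed
  have "height_step p A C"
  proof (cases "height C k = height A k")
    case True
    then have "height C = height A" using other by (metis ext)
    then show ?thesis by (simp add: height_step_def)
  next
    case False
    then have k: "height A k = 1" "height C k = p" using at by auto
    \<comment> \<open>Before \<open>k\<close> the heights of \<open>C\<close> are at least
      \<open>p\<close> and agree with those of \<open>A\<close>; from \<open>k\<close> on the
      heights of \<open>A\<close> are at most 1.\<close>
    have "i < k \<longleftrightarrow> height A i \<noteq> 1" for i
    proof
      assume "i < k"
      then have "p \<le> height A i"
        using decseqD[OF \<open>decseq (height C)\<close>, of i k] k other[of i] by simp
      then show "height A i \<noteq> 1" using prime_gt_1_nat[OF p] by simp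
    next
      assume "height A i \<noteq> 1"
      then show "i < k"
        using decseqD[OF \<open>decseq (height A)\<close>, of k i] k height_large[of i] prime_gt_1_nat[OF p]
        by (cases "i < k") auto
    qed
    moreover have "height C = (height A)(k := p)" using other k by auto
    ultimately show ?thesis unfolding height_step_def by blast
  qed
  moreover have "height A i \<noteq> p" for i
    using height_large[of i] prime_gt_1_nat[OF p] by (cases "height A i = 1") auto
  ultimately show ?thesis using that n A C unfolding p_def by blast
qed

text \<open>If nothing changed, \<open>p\<close> does not occur and the formula is the identity;
  otherwise \<open>p\<close> marks exactly the altered entry, which had height 1. The formula sees
  only \<open>p\<close> and the heights of the child, so it applies to measure classes.\<close>

lemma height_step_parent:
  assumes "height_step p A C" and "\<And>i. height A i \<noteq> p"
  shows "height A = (\<lambda>i. if height C i = p then 1 else height C i)"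
  using assms(1) unfolding height_step_def
proof (elim disjE exE conjE)
  assume "height C = height A"
  then show ?thesis using assms(2) by auto
next
  fix k assume k: "\<forall>i. i < k \<longleftrightarrow> height A i \<noteq> 1" "height C = (height A)(k := p)"
  have "height A k = 1" using spec[OF k(1), of k] by simp
  then show ?thesis using k(2) assms(2) by auto
qed

section \<open>Measure classes and the graph formed by them\<close>

text \<open>The logarithm is injective on positive numbers, so equal logarithmic heights mean equal
  heights.\<close>

lemma measure_class_eq_iff:
  assumes "A \<in> factorizations \<alpha>" "B \<in> factorizations \<alpha>"
  shows "measure_class \<alpha> A = measure_class \<alpha> B \<longleftrightarrow>
    (\<exists>\<beta>. factorization \<beta> A \<and> factorization \<beta> B) \<and> height A = height B"
proof -
  have log: "log_heights X = log_heights Y \<longleftrightarrow> height X = height Y"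
    if "X \<in> factorizations \<alpha>" "Y \<in> factorizations \<alpha>" for X Y
  proof -
    have "height X i > 0" "height Y i > 0" for i
      using that by (auto simp: factorizations_def factorization_def height_def less_max_iff_disj)
    then show ?thesis by (auto simp: log_heights_def fun_eq_iff)
  qed
  have "equiv (factorizations \<alpha>) (measure_equiv \<alpha>)"
  proof (intro equivI refl_onI symI transI)
    show "measure_equiv \<alpha> \<subseteq> factorizations \<alpha> \<times> factorizations \<alpha>"
      by (auto simp: measure_equiv_def)
  next
    fix X assume "X \<in> factorizations \<alpha>"
    then show "(X, X) \<in> measure_equiv \<alpha>"
      by (auto simp: measure_equiv_def factorizations_def)
  next
    fix X Y assume "(X, Y) \<in> measure_equiv \<alpha>"
    then show "(Y, X) \<in> measure_equiv \<alpha>" by (auto simp: measure_equiv_def)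
  next
    fix X Y Z assume "(X, Y) \<in> measure_equiv \<alpha>" "(Y, Z) \<in> measure_equiv \<alpha>"
    \<comment> \<open>The rationals witnessing the two pairs coincide, both being the product of the
      entries of \<open>Y\<close>.\<close>
    then show "(X, Z) \<in> measure_equiv \<alpha>"
      unfolding measure_equiv_def by simp (metis factorization_unique)
  qed
  then have "measure_class \<alpha> A = measure_class \<alpha> B \<longleftrightarrow> (A, B) \<in> measure_equiv \<alpha>"
    unfolding measure_class_def using assms by (rule eq_equiv_class_iff)
  then show ?thesis using assms log by (auto simp: measure_equiv_def)
qed

theorem theorem2p12:
  fixes \<alpha> :: rat
    and T :: "'v pair_pre_digraph" and \<nu> :: "'v \<Rightarrow> fraction_seq"
    and G :: "'g pair_pre_digraph" and \<mu> :: "'g \<Rightarrow> fraction_seq set"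
  assumes "\<alpha> > 0" and "squarefree_rat \<alpha>"
    and "primitive_factorization_tree \<alpha> T \<nu>"
    and "measure_class_graph \<alpha> T \<nu> G \<mu>"
  shows "binary_tree G"
proof -
  let ?N = "num_primes \<alpha>"
  have sf: "squarefree_rat \<alpha>" by fact
  have prim: "\<And>r. r \<in> pverts T \<Longrightarrow> primitive (\<nu> r)"
    and fac: "\<And>r. r \<in> pverts T \<Longrightarrow> \<nu> r \<in> factorizations \<alpha>"
    and direct: "\<And>r s. (r, s) \<in> parcs T \<Longrightarrow> direct_subfactorization \<alpha> (\<nu> r) (\<nu> s)"
    using assms(3)
    unfolding primitive_factorization_tree_def factorization_tree_def primitive_factorizations_def
    by blast+
  obtain r\<^sub>0 where tree: "rooted_tree T r\<^sub>0" and r\<^sub>0: "\<nu> r\<^sub>0 = (\<lambda>_. (1, 1))"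
    using assms(3) unfolding primitive_factorization_tree_def factorization_tree_def by blast
  have wfT: "pair_wf_digraph T" and r\<^sub>0_in: "r\<^sub>0 \<in> pverts T"
    and walks: "\<And>v. v \<in> pverts T \<Longrightarrow> \<exists>p. pre_digraph.awalk (with_proj T) r\<^sub>0 p v"
    using tree unfolding rooted_tree_def by blast+
  have wfG: "pair_wf_digraph G" and inj: "inj_on \<mu> (pverts G)"
    using assms(4) unfolding measure_class_graph_def by blast+
  obtain \<pi> where surj: "\<pi> ` pverts T = pverts G"
    and hom: "\<And>r s. (r, s) \<in> parcs T \<Longrightarrow> (\<pi> r, \<pi> s) \<in> parcs G"
    and mu: "\<And>r. r \<in> pverts T \<Longrightarrow> \<mu> (\<pi> r) = measure_class \<alpha> (\<nu> r)"
    and lift: "\<And>g h. g \<in> pverts G \<Longrightarrow> h \<in> pverts G \<Longrightarrow> (g, h) \<in> parcs G \<Longrightarrow>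
        \<exists>r s. (r, s) \<in> parcs T \<and> (\<pi> r, \<pi> s) = (g, h)"
  proof -
    from assms(4) obtain \<pi> where "\<pi> ` pverts T = pverts G"
      "\<forall>r s. (r, s) \<in> parcs T \<longrightarrow> (\<pi> r, \<pi> s) \<in> parcs G"
      "\<forall>r\<in>pverts T. \<mu> (\<pi> r) = measure_class \<alpha> (\<nu> r)"
      "\<forall>g\<in>\<pi> ` pverts T. \<forall>h\<in>\<pi> ` pverts T. (g, h) \<in> parcs G \<longrightarrow>
         (\<exists>r s. (r, s) \<in> parcs T \<and> (\<pi> r, \<pi> s) = (g, h))"
      unfolding measure_class_graph_def by (elim conjE exE) metis
    then show thesis by (intro that[of \<pi>]) simp_all
  qed
  \<comment> \<open>Injectivity of \<open>\<mu>\<close> reduces equality of vertices of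
    \<open>G\<close> to equality of measure classes, so the rational and the heights identify a
    vertex.\<close>
  have pi_eq: "\<pi> r = \<pi> s \<longleftrightarrow>
      (\<exists>\<beta>. factorization \<beta> (\<nu> r) \<and> factorization \<beta> (\<nu> s)) \<and> height (\<nu> r) = height (\<nu> s)"
    if "r \<in> pverts T" "s \<in> pverts T" for r s
  proof -
    have "\<pi> r = \<pi> s \<longleftrightarrow> \<mu> (\<pi> r) = \<mu> (\<pi> s)"
      using inj surj that by (metis imageI inj_on_eq_iff)
    then show ?thesis using mu measure_class_eq_iff fac that by simp
  qed
  \<comment> \<open>Every edge of \<open>G\<close> lifts to a tree edge, where primitivity of both
    ends gives a \<open>height_step\<close>.\<close>
  have edge: "\<exists>r s n. r \<in> pverts T \<and> s \<in> pverts T \<and> \<pi> r = g \<and> \<pi> s = h \<and> n < ?N \<and>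
      factorization (truncation \<alpha> n) (\<nu> r) \<and> factorization (truncation \<alpha> (Suc n)) (\<nu> s) \<and>
      height_step (prime_seq \<alpha> ! n) (\<nu> r) (\<nu> s) \<and> (\<forall>i. height (\<nu> r) i \<noteq> prime_seq \<alpha> ! n)"
    if "(g, h) \<in> parcs G" for g h
  proof -
    have "g \<in> pverts G" "h \<in> pverts G"
      using pair_wf_digraph.wellformed'[OF wfG that] by auto
    with lift that obtain r s where rs: "(r, s) \<in> parcs T" "\<pi> r = g" "\<pi> s = h" by blast
    then have "r \<in> pverts T" "s \<in> pverts T"
      using pair_wf_digraph.wellformed'[OF wfT rs(1)] by auto
    then show ?thesis
      using direct_subfactorization_height_step[OF sf prim prim direct[OF rs(1)]] rs by metis
  qed
  \<comment> \<open>Level and heights are invariants of the image under \<open>\<pi>\<close>,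
    independent of the representative.\<close>
  have level: "n = m \<and> height (\<nu> r) = height (\<nu> s)"
    if "\<pi> r = \<pi> s" "r \<in> pverts T" "s \<in> pverts T" "n \<le> ?N" "m \<le> ?N"
      "factorization (truncation \<alpha> n) (\<nu> r)" "factorization (truncation \<alpha> m) (\<nu> s)" for r s n m
    using that pi_eq[of r s] factorization_unique factorization_level_unique[OF sf, of n m "\<nu> r"]
    by metis
  have parent: "g = g'" if gh: "(g, h) \<in> parcs G" "(g', h) \<in> parcs G" for g g' h
  proof -
    obtain r s n where r: "r \<in> pverts T" "s \<in> pverts T" "\<pi> r = g" "\<pi> s = h" "n < ?N"
      "factorization (truncation \<alpha> n) (\<nu> r)" "factorization (truncation \<alpha> (Suc n)) (\<nu> s)"
      "height_step (prime_seq \<alpha> ! n) (\<nu> r) (\<nu> s)" "\<And>i. height (\<nu> r) i \<noteq> prime_seq \<alpha> ! n"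
      using edge[OF gh(1)] by blast
    obtain r' s' n' where r': "r' \<in> pverts T" "s' \<in> pverts T" "\<pi> r' = g'" "\<pi> s' = h" "n' < ?N"
      "factorization (truncation \<alpha> n') (\<nu> r')" "factorization (truncation \<alpha> (Suc n')) (\<nu> s')"
      "height_step (prime_seq \<alpha> ! n') (\<nu> r') (\<nu> s')" "\<And>i. height (\<nu> r') i \<noteq> prime_seq \<alpha> ! n'"
      using edge[OF gh(2)] by blast
    \<comment> \<open>The two lifts may end at different tree vertices, but these have the same
      image, hence the same level; so both steps adjoin the same prime.\<close>
    have "n = n'" "height (\<nu> s) = height (\<nu> s')"
      using level[of s s' "Suc n" "Suc n'"] r r' by auto
    then have "height (\<nu> r) = height (\<nu> r')"
      using height_step_parent[OF r(8,9)] height_step_parent[OF r'(8,9)] by (simp cong: if_cong)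
    then show ?thesis using pi_eq[of r r'] r r' \<open>n = n'\<close> by blast
  qed
  have root_fac: "factorization (truncation \<alpha> 0) (\<nu> r\<^sub>0)"
    by (simp add: r\<^sub>0 truncation_def factorization_def height_def)
  have root: "(u, \<pi> r\<^sub>0) \<notin> parcs G" for u
  proof
    assume "(u, \<pi> r\<^sub>0) \<in> parcs G"
    from edge[OF this] obtain s n where "s \<in> pverts T" "\<pi> s = \<pi> r\<^sub>0" "n < ?N"
      "factorization (truncation \<alpha> (Suc n)) (\<nu> s)" by blast
    \<comment> \<open>The target of an edge has level \<open>Suc n\<close>, whereas the root has
      level 0.\<close>
    then show False using level[of s r\<^sub>0 "Suc n" 0] root_fac r\<^sub>0_in by simp
  qed
  have reach: "\<exists>p. pre_digraph.awalk (with_proj G) (\<pi> r\<^sub>0) p v" if v: "v \<in> pverts G" for v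
  proof -
    obtain w p where "v = \<pi> w" "pre_digraph.awalk (with_proj T) r\<^sub>0 p w"
      using v surj walks by blast
    then show ?thesis using awalk_image[OF wfT wfG, of \<pi>] surj hom by blast
  qed
  have "rooted_tree G (\<pi> r\<^sub>0)"
    by (rule rooted_tree_if_unique_parent[OF wfG _ reach root parent]) (use r\<^sub>0_in surj in auto)
  moreover have "finite (children G g) \<and> card (children G g) \<le> 2" if g: "g \<in> pverts G" for g
  proof -
    from g have "g \<in> \<pi> ` pverts T" by (simp only: surj)
    then obtain r where r: "r \<in> pverts T" "\<pi> r = g" by auto
    obtain n where n: "n \<le> ?N" "factorization (truncation \<alpha> n) (\<nu> r)"
      using fac[OF r(1)] by (auto simp: factorizations_def)
    let ?H = "height (\<nu> r)"
    \<comment> \<open>\<open>LEAST\<close> names the position \<open>k\<close> of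
      \<open>height_step\<close>. For \<open>n = ?N\<close> the list index is out of range, but an
      edge leaving \<open>g\<close> would force \<open>n < ?N\<close>, so there are no children in
      that case.\<close>
    let ?X = "{?H, ?H((LEAST k. ?H k = 1) := prime_seq \<alpha> ! n)}"
    have "\<exists>s. s \<in> pverts T \<and> \<pi> s = h \<and> factorization (truncation \<alpha> (Suc n)) (\<nu> s) \<and>
        height (\<nu> s) \<in> ?X" if "h \<in> children G g" for h
    proof -
      have gh: "(g, h) \<in> parcs G" using that by (simp add: children_def)
      obtain r' s m where *: "r' \<in> pverts T" "s \<in> pverts T" "\<pi> r' = g" "\<pi> s = h" "m < ?N"
        "factorization (truncation \<alpha> m) (\<nu> r')" "factorization (truncation \<alpha> (Suc m)) (\<nu> s)"
        "height_step (prime_seq \<alpha> ! m) (\<nu> r') (\<nu> s)"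
        using edge[OF gh] by blast
      \<comment> \<open>The lifted edge starts at some \<open>r'\<close> that may differ from
        \<open>r\<close>; both lie over \<open>g\<close>, so level and heights carry over.\<close>
      then have "m = n" "height (\<nu> r') = ?H"
        using level[of r' r m n] r n by auto
      moreover have "(LEAST k. ?H k = 1) = k" if "\<forall>i. i < k \<longleftrightarrow> ?H i \<noteq> 1" for k
        using that by (intro Least_equality) (auto simp: not_less[symmetric])
      ultimately have "height (\<nu> s) \<in> ?X"
        using *(8) by (auto simp: height_step_def)
      then show ?thesis using * \<open>m = n\<close> by blast
    qed
    then obtain f where f: "\<And>h. h \<in> children G g \<Longrightarrow> f h \<in> pverts T \<and> \<pi> (f h) = h \<and>
        factorization (truncation \<alpha> (Suc n)) (\<nu> (f h)) \<and> height (\<nu> (f h)) \<in> ?X"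
      by metis
    \<comment> \<open>All chosen preimages have level \<open>Suc n\<close> and thus factor the same
      rational, so their heights alone determine their images.\<close>
    have "inj_on (\<lambda>h. height (\<nu> (f h))) (children G g)"
    proof (rule inj_onI)
      fix h h' assume h: "h \<in> children G g" "h' \<in> children G g"
        and eq: "height (\<nu> (f h)) = height (\<nu> (f h'))"
      have "\<pi> (f h) = \<pi> (f h')" using pi_eq[of "f h" "f h'"] f[OF h(1)] f[OF h(2)] eq by blast
      then show "h = h'" using f[OF h(1)] f[OF h(2)] by simp
    qed
    moreover have "(\<lambda>h. height (\<nu> (f h))) ` children G g \<subseteq> ?X" using f by blast
    moreover have "card ?X \<le> 2" by (simp add: card_insert_if)
    moreover have "finite ?X" by simp
    ultimately show ?thesis by (meson card_inj_on_le inj_on_finite le_trans)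
  qed
  ultimately show ?thesis unfolding binary_tree_def by blast
qed

end
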